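(* Let $\mathcal{H}$ be a complex Hilbert space of finite dimension $d$. Let $\rho_1,\rho_2\in\mathcal{D}(\mathcal{H})$ with $\frac12\|\rho_1-\rho_2\|_1=\varepsilon$ for some $\varepsilon\in[0,1]$. Let $\rho_+,\rho_-\in\mathcal{D}(\mathcal{H})$ with $\rho_+\perp\rho_-$ be the normalized Jordan-Hahn decomposition of $\rho_1-\rho_2$, i.e. $\rho_1-\rho_2=\varepsilon\rho_+-\varepsilon\rho_-$. Let $\mathcal{M}$ denote the support of $\rho_-$ and let $c:=\mathrm{Tr}\,\rho_2|_{\mathcal{M}}$. Then $$S(\rho_1)-S(\rho_2)\le \varepsilon S(\rho_+)-\varepsilon S(\rho_-)+c\,h\!\left(\frac{\varepsilon}{c}\right).$$
   Context: $\mathcal{D}(\mathcal{H})$ denotes the set of quantum states (density matrices) on $\mathcal{H}$: positive semi-definite operators of unit trace. $\|\cdot\|_1$ is the trace norm. $\log$ is the natural logarithm and $0\log 0=0$. The von Neumann entropy is $S(\rho)=-\mathrm{Tr}(\rho\log\rho)$, and $h(x)=-x\log x-(1-x)\log(1-x)$ is the binary entropy on $[0,1]$. The support of an operator $X$ is $\mathrm{supp}\,X=(\ker X)^\perp$. For a subspace $\mathcal{M}$ with orthogonal projection $P_{\mathcal{M}}$, $X|_{\mathcal{M}}$ denotes the restriction (compression) $P_{\mathcal{M}}XP_{\mathcal{M}}$ regarded as an operator on $\mathcal{M}$. $\rho_+\perp\rho_-$ means that the operators have orthogonal supports. The Jordan-Hahn decomposition writes $\rho_1-\rho_2=\Delta_+-\Delta_-$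 with $\Delta_\pm\ge 0$ of orthogonal supports; then $\Delta_\pm=\varepsilon\rho_\pm$ if $\varepsilon>0$, and if $\varepsilon=0$ the states $\rho_\pm$ are an arbitrary choice of states with orthogonal supports. It always holds that $0\le\varepsilon\le c\le 1$; the expression $c\,h(\varepsilon/c)$ is read as $0$ when $c=0$ (which can occur only if $\varepsilon=0$). *)

theory Defs
  imports "HOL-Analysis.Analysis"
begin

text \<open>
  A complex Hilbert space of finite dimension is taken to be \<open>complex ^ 'n\<close> with its standard
  sesquilinear inner product (antilinear in the first argument); operators are matrices
  \<open>complex ^ 'n ^ 'n\<close>.  The inner product of the library on this type is only the real part
  of \<open>cinner\<close>.
\<close>

definition cinner :: "complex ^ 'n \<Rightarrow> complex ^ 'n \<Rightarrow> complex" where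
  "cinner x y = (\<Sum>i\<in>UNIV. cnj (x $ i) * y $ i)"

definition cadjoint :: "complex ^ 'n ^ 'n \<Rightarrow> complex ^ 'n ^ 'n" where
  "cadjoint A = (\<chi> i j. cnj (A $ j $ i))"

definition hermitian :: "complex ^ 'n ^ 'n \<Rightarrow> bool" where
  "hermitian A \<longleftrightarrow> cadjoint A = A"

definition pos_semidef :: "complex ^ 'n ^ 'n \<Rightarrow> bool" where
  "pos_semidef A \<longleftrightarrow> hermitian A \<and> (\<forall>x. Re (cinner x (A *v x)) \<ge> 0)"

definition density_matrices :: "(complex ^ 'n ^ 'n) set" where
  "density_matrices = {A. pos_semidef A \<and> trace A = 1}"

definition corth_compl :: "(complex ^ 'n) set \<Rightarrow> (complex ^ 'n) set" where
  "corth_compl M = {x. \<forall>y\<in>M. cinner y x = 0}"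

definition mat_ker :: "complex ^ 'n ^ 'n \<Rightarrow> (complex ^ 'n) set" where
  "mat_ker A = {x. A *v x = 0}"

definition mat_supp :: "complex ^ 'n ^ 'n \<Rightarrow> (complex ^ 'n) set" where
  "mat_supp A = corth_compl (mat_ker A)"

definition orth_supports :: "complex ^ 'n ^ 'n \<Rightarrow> complex ^ 'n ^ 'n \<Rightarrow> bool" where
  "orth_supports A B \<longleftrightarrow> (\<forall>x\<in>mat_supp A. \<forall>y\<in>mat_supp B. cinner x y = 0)"

text \<open>The orthogonal projection onto \<open>M\<close>; only meaningful for complex-linear subspaces \<open>M\<close>.\<close>

definition orth_proj :: "(complex ^ 'n) set \<Rightarrow> complex ^ 'n ^ 'n" where
  "orth_proj M = (THE P. \<forall>x. P *v x \<in> M \<and> x - P *v x \<in> corth_compl M)"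

text \<open>
  The compression of \<open>X\<close> to \<open>M\<close>, kept as an operator on the whole space that vanishes on the
  orthogonal complement of \<open>M\<close>; its trace is that of the operator on \<open>M\<close>.
\<close>

definition compression :: "(complex ^ 'n) set \<Rightarrow> complex ^ 'n ^ 'n \<Rightarrow> complex ^ 'n ^ 'n" where
  "compression M X = orth_proj M ** X ** orth_proj M"

definition eigenspace :: "complex ^ 'n ^ 'n \<Rightarrow> real \<Rightarrow> (complex ^ 'n) set" where
  "eigenspace A t = {v. A *v v = complex_of_real t *s v}"

definition real_spectrum :: "complex ^ 'n ^ 'n \<Rightarrow> real set" where
  "real_spectrum A = {t. \<exists>v\<in>eigenspace A t. v \<noteq> 0}"

text \<open>
  Functional calculus \<open>f(A) = (\<Sum>t. f t *\<^sub>R P\<^sub>t)\<close>, with \<open>P\<^sub>t\<close> the spectral projections, for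
  Hermitian \<open>A\<close>; all eigenvalues are then real.
\<close>

definition herm_fun :: "(real \<Rightarrow> real) \<Rightarrow> complex ^ 'n ^ 'n \<Rightarrow> complex ^ 'n ^ 'n" where
  "herm_fun f A = (\<Sum>t\<in>real_spectrum A. f t *\<^sub>R orth_proj (eigenspace A t))"

definition mat_abs :: "complex ^ 'n ^ 'n \<Rightarrow> complex ^ 'n ^ 'n" where
  "mat_abs A = herm_fun sqrt (cadjoint A ** A)"

definition trace_norm :: "complex ^ 'n ^ 'n \<Rightarrow> real" where
  "trace_norm A = Re (trace (mat_abs A))"

text \<open>
  The kernel of \<open>A\<close> contributes nothing to \<open>A log A\<close>, which is the convention
  \<open>0 log 0 = 0\<close>; likewise below, where \<open>0 * ln 0 = 0\<close>.
\<close>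

definition vn_entropy :: "complex ^ 'n ^ 'n \<Rightarrow> real" where
  "vn_entropy A = - Re (trace (A ** herm_fun ln A))"

definition binary_entropy :: "real \<Rightarrow> real" where
  "binary_entropy x = - x * ln x - (1 - x) * ln (1 - x)"

end

theory Submission
  imports Defs "HOL-Real_Asymp.Real_Asymp"
begin

text \<open>
  Put \<open>X = \<rho>1 + \<epsilon> \<rho>m = \<rho>2 + \<epsilon> \<rho>p\<close> and bound \<open>S(X)\<close> from both sides, where \<open>S(X) = - Tr (X log X)\<close> also for
  unnormalised \<open>X\<close>.

  From above: \<open>X\<close> dominates \<open>\<rho>2\<close> and \<open>\<epsilon> \<rho>p\<close>, so monotonicity of the logarithm gives
  \<open>S(X) \<le> S(\<rho>2) + \<epsilon> S(\<rho>p) - \<epsilon> log \<epsilon>\<close>.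

  From below: along \<open>X(t) = \<rho>1 + t \<rho>m\<close>, Klein's inequality bounds the increments of \<open>S(X(t))\<close> by
  \<open>- Tr (\<rho>m log X(t)) - 1\<close>, and \<open>Tr (\<rho>m log X(t)) \<le> - S(\<rho>m) + log (\<alpha> + t)\<close> where
  \<open>\<alpha> = c - \<epsilon>\<close> is the mass of \<open>\<rho>1\<close> on the support of \<open>\<rho>m\<close>. Integrating over \<open>[0, \<epsilon>]\<close> gives
  \<open>S(X) \<ge> S(\<rho>1) + \<epsilon> S(\<rho>m) - c log c + (c - \<epsilon>) log (c - \<epsilon>)\<close>, which is what is needed because
  \<open>c h(\<epsilon>/c) = c log c - \<epsilon> log \<epsilon> - (c - \<epsilon>) log (c - \<epsilon>)\<close>.
\<close>

subsection \<open>Eigenbases of Hermitian matrices\<close>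

lemma cinner_commute: "cinner y x = cnj (cinner x y)"
  by (simp add: cinner_def mult.commute)

lemma cinner_add_left: "cinner (x + y) z = cinner x z + cinner y z"
  and cinner_add_right: "cinner z (x + y) = cinner z x + cinner z y"
  and cinner_diff_left: "cinner (x - y) z = cinner x z - cinner y z"
  and cinner_diff_right: "cinner z (x - y) = cinner z x - cinner z y"
  by (simp_all add: cinner_def algebra_simps sum.distrib sum_subtractf)

lemma cinner_scale_left: "cinner (k *s x) z = cnj k * cinner x z"
  and cinner_scale_right: "cinner z (k *s x) = k * cinner z x"
  by (simp_all add: cinner_def sum_distrib_left algebra_simps)

lemma cinner_zero [simp]: "cinner 0 x = 0" "cinner x 0 = 0"
  by (simp_all add: cinner_def)

lemma cinner_sum_right: "cinner z (\<Sum>i\<in>I. f i) = (\<Sum>i\<in>I. cinner z (f i))"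
  by (induction I rule: infinite_finite_induct) (simp_all add: cinner_add_right)

lemma inner_eq_Re_cinner: "x \<bullet> y = Re (cinner x y)"
  by (simp add: inner_vec_def cinner_def inner_complex_def)

lemma cinner_self: "cinner x x = of_real ((norm x)\<^sup>2)"
proof -
  have "Im (cinner x x) = 0"
    using cinner_commute[of x x] by (simp add: complex_eq_iff)
  then show ?thesis
    by (simp add: complex_eq_iff power2_norm_eq_inner inner_eq_Re_cinner)
qed

lemma cinner_eq_zero_iff [simp]: "cinner x x = 0 \<longleftrightarrow> x = 0"
  by (simp add: cinner_self)

lemma matrix_vector_mult_sum: "A *v (\<Sum>i\<in>I. f i) = (\<Sum>i\<in>I. A *v f i)"
  by (induction I rule: infinite_finite_induct) (simp_all add: matrix_vector_right_distrib)

lemma scaleR_matrix_vector_mult: "(r *\<^sub>R A) *v x = of_real r *s (A *v x)"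
  for A :: "complex ^ 'n ^ 'm"
  by (simp add: vec_eq_iff matrix_vector_mult_def scaleR_sum_right scaleR_conv_of_real[symmetric])

lemma cinner_adjoint: "cinner x (A *v y) = cinner (cadjoint A *v x) y"
proof -
  have "cinner x (A *v y) = (\<Sum>i\<in>UNIV. \<Sum>j\<in>UNIV. cnj (x $ i) * A $ i $ j * y $ j)"
    by (simp add: cinner_def matrix_vector_mult_def sum_distrib_left mult.assoc)
  also have "\<dots> = (\<Sum>j\<in>UNIV. \<Sum>i\<in>UNIV. cnj (x $ i) * A $ i $ j * y $ j)"
    by (rule sum.swap)
  also have "\<dots> = cinner (cadjoint A *v x) y"
    by (simp add: cinner_def matrix_vector_mult_def cadjoint_def sum_distrib_left sum_distrib_right mult_ac)
  finally show ?thesis .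
qed

lemma hermitian_cinner: "hermitian A \<Longrightarrow> cinner x (A *v y) = cinner (A *v x) y"
  by (simp add: cinner_adjoint hermitian_def)

text \<open>For a unit eigenvector \<open>v\<close> of a Hermitian matrix this is the eigenvalue, which lets eigenbases
  be handled as plain sets of vectors.\<close>

definition rayleigh :: "complex ^ 'n ^ 'n \<Rightarrow> complex ^ 'n \<Rightarrow> real" where
  "rayleigh A v = Re (cinner v (A *v v))"

definition orthonormal :: "(complex ^ 'n) set \<Rightarrow> bool" where
  "orthonormal E \<longleftrightarrow> (\<forall>e\<in>E. \<forall>f\<in>E. cinner e f = (if e = f then 1 else 0))"

definition orthonormal_basis :: "(complex ^ 'n) set \<Rightarrow> bool" where
  "orthonormal_basis E \<longleftrightarrow> finite E \<and> orthonormal E \<and> (\<forall>x. x = (\<Sum>e\<in>E. cinner e x *s e))"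

definition eigenbasis :: "complex ^ 'n ^ 'n \<Rightarrow> (complex ^ 'n) set \<Rightarrow> bool" where
  "eigenbasis A E \<longleftrightarrow> orthonormal_basis E \<and> (\<forall>e\<in>E. A *v e = of_real (rayleigh A e) *s e)"

text \<open>Orthogonality for \<open>cinner\<close> implies orthogonality for the real inner
  product, hence independence over the reals. The real dimension is twice the sharp bound, but any
  bound makes a largest orthonormal set of eigenvectors exist.\<close>

lemma orthonormal_finite_card:
  assumes "orthonormal (E :: (complex ^ 'n) set)"
  shows "finite E \<and> card E \<le> DIM(complex ^ 'n)"
proof -
  have "pairwise orthogonal E"
    using assms by (auto simp: pairwise_def orthogonal_def orthonormal_def inner_eq_Re_cinner)
  moreover have "0 \<notin> E"
    using assms by (force simp: orthonormal_def)
  ultimately have "independent E"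
    by (rule pairwise_orthogonal_independent)
  then show ?thesis
    by (rule independent_bound)
qed

text \<open>A maximiser of the Rayleigh quotient on an invariant subspace is an eigenvector.\<close>

lemma hermitian_eigenvector_in_invariant_compl:
  fixes A :: "complex ^ 'n ^ 'n"
  assumes herm: "hermitian A"
    and inv: "\<And>x. x \<in> corth_compl E \<Longrightarrow> A *v x \<in> corth_compl E"
    and x0: "x0 \<in> corth_compl E" "x0 \<noteq> 0"
  obtains v where "v \<in> corth_compl E" "cinner v v = 1" "A *v v = of_real (rayleigh A v) *s v"
proof -
  define V where "V = corth_compl E"
  have V_add: "x + y \<in> V" and V_diff: "x - y \<in> V" and V_scale: "k *s x \<in> V"
    if "x \<in> V" "y \<in> V" for x y k
    using that by (auto simp: V_def corth_compl_def cinner_add_right cinner_diff_right cinner_scale_right)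
  have A_V: "A *v x \<in> V" if "x \<in> V" for x
    using inv that by (simp add: V_def)
  define S where "S = V \<inter> sphere 0 1"
  have cont: "continuous_on T (\<lambda>x. cinner y x)" for T and y :: "complex ^ 'n"
    unfolding cinner_def by (intro continuous_intros)
  have "V = (\<Inter>y\<in>E. {x. cinner y x = 0})"
    by (auto simp: V_def corth_compl_def)
  moreover have "closed {x. cinner y x = 0}" for y :: "complex ^ 'n"
    by (intro closed_Collect_eq cont continuous_on_const)
  ultimately have "closed V"
    by auto
  then have "compact S"
    unfolding S_def by (simp add: closed_Int_compact)
  have norm_scale: "norm (k *s x) = cmod k * norm x" for k and x :: "complex ^ 'n"
  proof -
    have "of_real ((norm (k *s x))\<^sup>2) = (of_real ((cmod k * norm x)\<^sup>2) :: complex)"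
      by (simp add: cinner_self[symmetric] cinner_scale_left cinner_scale_right
          power_mult_distrib complex_norm_square mult_ac flip: of_real_power)
    then show ?thesis
      by (simp only: of_real_eq_iff power2_eq_iff_nonneg norm_ge_zero mult_nonneg_nonneg)
  qed
  have unit: "of_real (1 / norm x) *s x \<in> S" if "x \<in> V" "x \<noteq> 0" for x
    using that V_scale by (simp add: S_def norm_scale norm_divide)
  then have "S \<noteq> {}"
    using x0 by (auto simp: V_def)
  have "continuous_on S (rayleigh A)"
    unfolding rayleigh_def cinner_def matrix_vector_mult_def by (intro continuous_intros)
  then obtain v where v: "v \<in> S" and max: "\<And>y. y \<in> S \<Longrightarrow> rayleigh A y \<le> rayleigh A v"
    using continuous_attains_sup[OF \<open>compact S\<close> \<open>S \<noteq> {}\<close>] by blast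
  define l where "l = rayleigh A v"
  have vv: "cinner v v = 1" "v \<in> V"
    using v by (simp_all add: S_def cinner_self)
  \<comment> \<open>By maximality of \<open>l\<close> the form of \<open>B\<close> is nonnegative on
    \<open>V\<close>, and it vanishes at \<open>v\<close>. This forces \<open>B v = 0\<close>, which
    is the eigenvector equation.\<close>
  define B where "B x = of_real l *s x - A *v x" for x
  have B_V: "B x \<in> V" if "x \<in> V" for x
    using that A_V V_diff V_scale by (simp add: B_def)
  have B_add: "B (x + y) = B x + B y" and B_scale: "B (k *s x) = k *s B x" for x y k
    by (simp_all add: B_def matrix_vector_right_distrib vector_add_ldistrib vector_scalar_commute
        vector_ssub_ldistrib mult.commute)
  have B_sym: "cinner x (B y) = cinner (B x) y" for x y
    using herm by (simp add: B_def cinner_diff_left cinner_diff_right cinner_scale_left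
        cinner_scale_right hermitian_cinner)
  have B_nonneg: "Re (cinner x (B x)) \<ge> 0" if "x \<in> V" for x
  proof (cases "x = 0")
    case False
    have "rayleigh A (of_real (1 / norm x) *s x) \<le> l"
      using max unit False that by (simp add: l_def)
    then have "Re (cinner x (A *v x)) \<le> l * (norm x)\<^sup>2"
      using False by (simp add: rayleigh_def vector_scalar_commute cinner_scale_left
          cinner_scale_right field_simps power2_eq_square)
    then show ?thesis
      by (simp add: B_def cinner_diff_right cinner_scale_right cinner_self)
  qed simp
  have Bv0: "Re (cinner v (B v)) = 0"
    using vv by (simp add: B_def cinner_diff_right cinner_scale_right l_def rayleigh_def)
  define y where "y = B v"
  have "y \<in> V"
    using B_V vv by (simp add: y_def)
  define q where "q = Re (cinner y (B y))"
  define p where "p = (norm y)\<^sup>2"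
  \<comment> \<open>Perturbing \<open>v\<close> in the direction \<open>y = B v\<close> gives a
    quadratic in \<open>s\<close> without constant term, with linear coefficient twice the squared
    norm of \<open>y\<close>. For small negative \<open>s\<close> it would be negative unless
    \<open>y = 0\<close>.\<close>
  have quad: "0 \<le> 2 * s * p + s\<^sup>2 * q" for s :: real
  proof -
    have "0 \<le> Re (cinner (v + of_real s *s y) (B (v + of_real s *s y)))"
      using B_nonneg V_add V_scale vv \<open>y \<in> V\<close> by blast
    also have "\<dots> = s * Re (cinner v (B y)) + s * Re (cinner y (B v)) + s\<^sup>2 * q"
      using Bv0 by (simp add: B_add B_scale cinner_add_left cinner_add_right cinner_scale_left
          cinner_scale_right q_def power2_eq_square algebra_simps)
    also have "\<dots> = 2 * s * p + s\<^sup>2 * q"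
      using B_sym[of v y] by (simp add: y_def[symmetric] cinner_self p_def)
    finally show ?thesis .
  qed
  have "p = 0"
  proof (rule ccontr)
    assume "p \<noteq> 0"
    then have p: "p > 0" by (simp add: p_def)
    have q: "q \<ge> 0" using B_nonneg \<open>y \<in> V\<close> by (simp add: q_def)
    \<comment> \<open>With this choice the quadratic becomes \<open>s * (p - s)\<close>. The
      \<open>+ 1\<close> keeps the denominator positive when \<open>q = 0\<close>.\<close>
    define s where "s = - p / (q + 1)"
    have s: "s < 0" "s * q = - p - s"
      using p q by (simp_all add: s_def field_simps)
    have "2 * s * p + s\<^sup>2 * q = s * (2 * p + s * q)"
      by (simp add: power2_eq_square algebra_simps)
    also have "\<dots> = s * (p - s)"
      using s by simp
    also have "\<dots> < 0"
      using s p by (intro mult_neg_pos) auto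
    finally show False using quad[of s] by simp
  qed
  then have "A *v v = of_real (rayleigh A v) *s v"
    by (simp add: p_def y_def B_def l_def)
  then show ?thesis
    using vv that by (auto simp: V_def)
qed

text \<open>An orthonormal set of eigenvectors of largest cardinality spans: its orthogonal
  complement is invariant because \<open>A\<close> is Hermitian, so a nonzero complement would
  contain a further unit eigenvector.\<close>

lemma hermitian_eigenbasis:
  fixes A :: "complex ^ 'n ^ 'n"
  assumes herm: "hermitian A"
  obtains E where "eigenbasis A E"
proof -
  define Q where "Q E \<longleftrightarrow> orthonormal E \<and> (\<forall>e\<in>E. A *v e = of_real (rayleigh A e) *s e)" for E
  have "Q {}"
    by (simp add: Q_def orthonormal_def)
  moreover have "\<forall>E. Q E \<longrightarrow> card E < Suc DIM(complex ^ 'n)"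
    using orthonormal_finite_card by (auto simp: Q_def less_Suc_eq_le)
  ultimately obtain E where E: "Q E" and max: "\<And>F. Q F \<Longrightarrow> card F \<le> card E"
    using ex_has_greatest_nat[of Q "{}" card] by metis
  have on: "orthonormal E" and fin: "finite E"
    and eig: "\<And>e. e \<in> E \<Longrightarrow> A *v e = of_real (rayleigh A e) *s e"
    using E orthonormal_finite_card by (auto simp: Q_def)
  have inv: "A *v x \<in> corth_compl E" if "x \<in> corth_compl E" for x
    using that herm by (auto simp: corth_compl_def hermitian_cinner eig cinner_scale_left)
  have compl: "x = 0" if x: "x \<in> corth_compl E" for x
  proof (rule ccontr)
    assume "x \<noteq> 0"
    then obtain v where v: "v \<in> corth_compl E" "cinner v v = 1" "A *v v = of_real (rayleigh A v) *s v"
      using hermitian_eigenvector_in_invariant_compl[OF herm inv x] by blast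
    have "cinner v e = 0" if "e \<in> E" for e
      using v that cinner_commute[of v e] by (simp add: corth_compl_def)
    then have "Q (insert v E)"
      using E v by (auto simp: Q_def orthonormal_def corth_compl_def)
    moreover have "v \<notin> E"
      using v by (auto simp: corth_compl_def)
    ultimately show False
      using max[of "insert v E"] fin by simp
  qed
  have "x = (\<Sum>e\<in>E. cinner e x *s e)" for x
  proof -
    have "cinner y (\<Sum>e\<in>E. cinner e x *s e) = cinner y x" if "y \<in> E" for y
    proof -
      have "cinner y (\<Sum>e\<in>E. cinner e x *s e) = (\<Sum>e\<in>E. if y = e then cinner e x else 0)"
        unfolding cinner_sum_right cinner_scale_right
        using on that by (intro sum.cong) (auto simp: orthonormal_def)
      then show ?thesis using fin that by simp
    qed
    then have "x - (\<Sum>e\<in>E. cinner e x *s e) \<in> corth_compl E"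
      by (simp add: corth_compl_def cinner_diff_right)
    then show ?thesis using compl by force
  qed
  then have "eigenbasis A E"
    using on fin eig by (simp add: eigenbasis_def orthonormal_basis_def)
  then show ?thesis by (rule that)
qed

subsection \<open>Traces and functional calculus in an eigenbasis\<close>

lemma orthonormal_basisD:
  assumes "orthonormal_basis E"
  shows "finite E" "x = (\<Sum>e\<in>E. cinner e x *s e)"
    "\<lbrakk>e \<in> E; f \<in> E\<rbrakk> \<Longrightarrow> cinner e f = (if e = f then 1 else 0)"
  using assms unfolding orthonormal_basis_def orthonormal_def by blast+

lemma eigenbasisD:
  assumes "eigenbasis A E"
  shows "orthonormal_basis E" "e \<in> E \<Longrightarrow> A *v e = of_real (rayleigh A e) *s e"
  using assms by (simp_all add: eigenbasis_def)

lemma orthonormal_basis_cinner: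
  assumes "orthonormal_basis E"
  shows "cinner x y = (\<Sum>e\<in>E. cnj (cinner e x) * cinner e y)"
proof -
  have "cinner x y = cinner x (\<Sum>e\<in>E. cinner e y *s e)"
    using orthonormal_basisD(2)[OF assms] by metis
  also have "\<dots> = (\<Sum>e\<in>E. cnj (cinner e x) * cinner e y)"
    by (simp add: cinner_sum_right cinner_scale_right cinner_commute[symmetric] mult.commute)
  finally show ?thesis .
qed

lemma orthonormal_basis_parseval:
  assumes "orthonormal_basis E"
  shows "(\<Sum>e\<in>E. (cmod (cinner e x))\<^sup>2) = (norm x)\<^sup>2"
proof -
  have "complex_of_real ((norm x)\<^sup>2) = of_real (\<Sum>e\<in>E. (cmod (cinner e x))\<^sup>2)"
    unfolding cinner_self[symmetric] orthonormal_basis_cinner[OF assms, of x x] of_real_sum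
    by (simp add: complex_norm_square mult.commute flip: of_real_power)
  then show ?thesis
    by (simp only: of_real_eq_iff)
qed

lemma orthonormal_basis_eqI:
  assumes "orthonormal_basis E" "\<And>e. e \<in> E \<Longrightarrow> cinner e x = cinner e y"
  shows "x = y"
proof -
  have "x = (\<Sum>e\<in>E. cinner e x *s e)" "y = (\<Sum>e\<in>E. cinner e y *s e)"
    using orthonormal_basisD(2)[OF assms(1)] by blast+
  then show ?thesis
    using assms(2) by (metis (no_types, lifting) sum.cong)
qed

lemma orthonormal_basis_norm: "orthonormal_basis E \<Longrightarrow> e \<in> E \<Longrightarrow> norm e = 1"
  using orthonormal_basisD(3)[of E e e] by (simp add: cinner_self abs_square_eq_1 flip: of_real_power)

lemma cinner_expansion:
  assumes "orthonormal_basis E" "F \<subseteq> E" "e \<in> E"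
  shows "cinner e (\<Sum>f\<in>F. c f *s f) = (if e \<in> F then c e else 0)"
proof -
  have "cinner e (\<Sum>f\<in>F. c f *s f) = (\<Sum>f\<in>F. if e = f then c f else 0)"
    unfolding cinner_sum_right cinner_scale_right
    using assms by (intro sum.cong) (auto simp: orthonormal_basisD(3))
  then show ?thesis
    using finite_subset[OF assms(2) orthonormal_basisD(1)[OF assms(1)]] by simp
qed

text \<open>Expanding the standard unit vectors in \<open>E\<close> gives the completeness relation
  \<open>delta\<close>, which reduces the sum over \<open>E\<close> to the diagonal of
  \<open>X\<close>.\<close>

lemma trace_orthonormal_basis:
  assumes "orthonormal_basis E"
  shows "trace X = (\<Sum>e\<in>E. cinner e (X *v e))"
proof -
  have delta: "(\<Sum>e\<in>E. cnj (e $ i) * e $ k) = (if k = i then 1 else 0)" for i k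
  proof -
    have "axis i 1 $ k = (\<Sum>e\<in>E. cinner e (axis i 1) *s e) $ k"
      using orthonormal_basisD(2)[OF assms] by metis
    moreover have "cinner e (axis i 1) = cnj (e $ i)" for e :: "complex ^ 'a"
      by (simp add: cinner_def axis_def if_distrib sum.delta cong: if_cong)
    ultimately show ?thesis by (simp add: axis_def)
  qed
  have "(\<Sum>e\<in>E. cinner e (X *v e)) = (\<Sum>e\<in>E. \<Sum>i\<in>UNIV. \<Sum>k\<in>UNIV. X $ i $ k * (cnj (e $ i) * e $ k))"
    by (simp add: cinner_def matrix_vector_mult_def sum_distrib_left mult_ac)
  also have "\<dots> = (\<Sum>i\<in>UNIV. \<Sum>k\<in>UNIV. \<Sum>e\<in>E. X $ i $ k * (cnj (e $ i) * e $ k))"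
    by (subst sum.swap, rule sum.cong[OF refl], rule sum.swap)
  also have "\<dots> = (\<Sum>i\<in>UNIV. \<Sum>k\<in>UNIV. X $ i $ k * (if k = i then 1 else 0))"
    by (simp add: delta sum_distrib_left[symmetric])
  also have "\<dots> = trace X"
    by (simp add: trace_def if_distrib sum.delta cong: if_cong)
  finally show ?thesis by simp
qed

lemma Re_trace_orthonormal_basis:
  "orthonormal_basis E \<Longrightarrow> Re (trace X) = (\<Sum>e\<in>E. rayleigh X e)"
  by (simp add: trace_orthonormal_basis rayleigh_def)

text \<open>\<open>M\<close> is the span of \<open>F\<close>, described by the vanishing of the
  remaining coefficients. The sum of the rank-one projections onto the members of \<open>F\<close>
  meets the description in \<open>orth_proj\<close>; it is unique because the values of two
  candidates differ by a vector that lies in \<open>M\<close> and is orthogonal to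
  \<open>M\<close>.\<close>

lemma orth_proj_mult:
  fixes E :: "(complex ^ 'n) set"
  assumes onb: "orthonormal_basis E" and "F \<subseteq> E"
    and M: "M = {x. \<forall>e\<in>E - F. cinner e x = 0}"
  shows "orth_proj M *v x = (\<Sum>e\<in>F. cinner e x *s e)"
proof -
  define Q :: "complex ^ 'n ^ 'n" where "Q = (\<chi> i j. \<Sum>e\<in>F. e $ i * cnj (e $ j))"
  have Q: "Q *v x = (\<Sum>e\<in>F. cinner e x *s e)" for x
  proof -
    have "(\<Sum>j\<in>UNIV. (\<Sum>e\<in>F. e $ i * cnj (e $ j)) * x $ j) = (\<Sum>e\<in>F. cinner e x * e $ i)" for i
      unfolding cinner_def sum_distrib_right by (subst sum.swap) (simp add: mult_ac)
    then show ?thesis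
      by (simp add: Q_def vec_eq_iff matrix_vector_mult_def)
  qed
  have inM: "Q *v x \<in> M" for x
    using cinner_expansion[OF onb \<open>F \<subseteq> E\<close>] by (simp add: Q M)
  have compl: "x - Q *v x \<in> corth_compl M" for x
  proof -
    have "cinner y (x - Q *v x) = 0" if "y \<in> M" for y
      unfolding orthonormal_basis_cinner[OF onb, of y]
      using that \<open>F \<subseteq> E\<close>
      by (intro sum.neutral) (auto simp: cinner_expansion[OF onb] cinner_diff_right Q M)
    then show ?thesis by (simp add: corth_compl_def)
  qed
  have "orth_proj M = Q"
    unfolding orth_proj_def
  proof (rule the_equality)
    show "\<forall>x. Q *v x \<in> M \<and> x - Q *v x \<in> corth_compl M"
      using inM compl by blast
  next
    fix P assume P: "\<forall>x. P *v x \<in> M \<and> x - P *v x \<in> corth_compl M"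
    have "P *v x = Q *v x" for x
    proof -
      define z where "z = P *v x - Q *v x"
      have "z \<in> M"
        using P inM by (auto simp: z_def M cinner_diff_right)
      have "z = (x - Q *v x) - (x - P *v x)"
        by (simp add: z_def)
      then have "cinner z z = cinner z (x - Q *v x) - cinner z (x - P *v x)"
        by (metis cinner_diff_right)
      also have "\<dots> = 0"
        using \<open>z \<in> M\<close> P compl by (simp add: corth_compl_def)
      finally show ?thesis by (simp add: z_def)
    qed
    then show "P = Q" by (simp add: matrix_eq)
  qed
  then show ?thesis by (simp add: Q)
qed

section \<open>Spectral projections and functional calculus\<close>

lemma eigenspace_eigenbasis:
  assumes "hermitian A" "eigenbasis A E"
  shows "eigenspace A t = {x. \<forall>e\<in>E - {e\<in>E. rayleigh A e = t}. cinner e x = 0}"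
proof -
  have "A *v x = of_real t *s x \<longleftrightarrow> (\<forall>e\<in>E. cinner e (A *v x) = of_real t * cinner e x)" for x
    using orthonormal_basis_eqI[OF eigenbasisD(1)[OF assms(2)], of "A *v x" "of_real t *s x"]
    by (auto simp: cinner_scale_right)
  moreover have "cinner e (A *v x) = of_real (rayleigh A e) * cinner e x" if "e \<in> E" for e x
    using that assms by (simp add: hermitian_cinner eigenbasisD(2) cinner_scale_left)
  ultimately show ?thesis
    by (auto simp: eigenspace_def)
qed

lemma real_spectrum_eigenbasis:
  assumes "hermitian A" "eigenbasis A E"
  shows "real_spectrum A = rayleigh A ` E"
proof (intro equalityI subsetI)
  fix t assume "t \<in> real_spectrum A"
  then obtain v where v: "v \<in> eigenspace A t" "v \<noteq> 0"
    by (auto simp: real_spectrum_def)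
  show "t \<in> rayleigh A ` E"
  proof (rule ccontr)
    assume "t \<notin> rayleigh A ` E"
    then have "cinner e v = 0" if "e \<in> E" for e
      using v that by (auto simp: eigenspace_eigenbasis[OF assms])
    then show False
      using v orthonormal_basis_eqI[OF eigenbasisD(1)[OF assms(2)], of v 0] by simp
  qed
next
  fix t assume "t \<in> rayleigh A ` E"
  then obtain e where e: "e \<in> E" "t = rayleigh A e" by blast
  then have "e \<noteq> 0"
    using orthonormal_basis_norm[OF eigenbasisD(1)[OF assms(2)]] by force
  then show "t \<in> real_spectrum A"
    using e eigenbasisD(2)[OF assms(2)] by (auto simp: real_spectrum_def eigenspace_def)
qed

text \<open>Each spectral projection is a sum over the basis vectors with that eigenvalue;
  regrouping turns the sum over the spectrum into one over \<open>E\<close>, multiplicities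
  included.\<close>

lemma herm_fun_mult:
  fixes A :: "complex ^ 'n ^ 'n"
  assumes "hermitian A" "eigenbasis A E"
  shows "herm_fun f A *v x = (\<Sum>e\<in>E. (of_real (f (rayleigh A e)) * cinner e x) *s e)"
proof -
  note onb = eigenbasisD(1)[OF assms(2)]
  have distrib: "(\<Sum>t\<in>T. f t *\<^sub>R P t) *v x = (\<Sum>t\<in>T. of_real (f t) *s (P t *v x))"
    for T and P :: "real \<Rightarrow> complex ^ 'n ^ 'n"
    by (induction T rule: infinite_finite_induct)
      (simp_all add: matrix_vector_mult_add_rdistrib scaleR_matrix_vector_mult)
  have "herm_fun f A *v x
      = (\<Sum>t\<in>rayleigh A ` E. of_real (f t) *s (orth_proj (eigenspace A t) *v x))"
    unfolding herm_fun_def real_spectrum_eigenbasis[OF assms]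
    by (rule distrib)
  also have "\<dots> = (\<Sum>t\<in>rayleigh A ` E. \<Sum>e\<in>{e\<in>E. rayleigh A e = t}.
      (of_real (f (rayleigh A e)) * cinner e x) *s e)"
    by (intro sum.cong refl, subst orth_proj_mult[OF onb _ eigenspace_eigenbasis[OF assms]])
      (auto simp: vec_eq_iff sum_distrib_left mult.assoc intro!: sum.cong)
  also have "\<dots> = (\<Sum>e\<in>E. (of_real (f (rayleigh A e)) * cinner e x) *s e)"
    by (rule sum.image_gen[symmetric]) (rule orthonormal_basisD(1)[OF onb])
  finally show ?thesis .
qed

lemma rayleigh_herm_fun:
  assumes "hermitian A" "eigenbasis A E"
  shows "rayleigh (herm_fun f A) v = (\<Sum>e\<in>E. f (rayleigh A e) * (cmod (cinner e v))\<^sup>2)"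
proof -
  have "cinner v (herm_fun f A *v v) = of_real (\<Sum>e\<in>E. f (rayleigh A e) * (cmod (cinner e v))\<^sup>2)"
    unfolding herm_fun_mult[OF assms] cinner_sum_right cinner_scale_right of_real_sum
    by (intro sum.cong refl)
      (simp add: complex_norm_square cinner_commute[of v] flip: of_real_power)
  then show ?thesis by (simp add: rayleigh_def)
qed

lemma rayleigh_eigenbasis:
  assumes "hermitian A" "eigenbasis A E"
  shows "rayleigh A v = (\<Sum>e\<in>E. rayleigh A e * (cmod (cinner e v))\<^sup>2)"
proof -
  have "A *v v = A *v (\<Sum>e\<in>E. cinner e v *s e)"
    using orthonormal_basisD(2)[OF eigenbasisD(1)[OF assms(2)]] by metis
  also have "\<dots> = (\<Sum>e\<in>E. (of_real (rayleigh A e) * cinner e v) *s e)"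
    unfolding matrix_vector_mult_sum vector_scalar_commute
    by (intro sum.cong refl) (simp add: eigenbasisD(2)[OF assms(2)] mult.commute)
  also have "\<dots> = herm_fun (\<lambda>t. t) A *v v"
    by (simp add: herm_fun_mult[OF assms])
  finally show ?thesis
    using rayleigh_herm_fun[OF assms, of "\<lambda>t. t" v] by (simp add: rayleigh_def)
qed

text \<open>The cross term Tr (D log X) of the relative entropy. Since \<open>ln 0 = 0\<close>, the
  kernel of \<open>X\<close> contributes zero, so the bounds below carry conditions that make
  \<open>D\<close> vanish on that kernel.\<close>

definition trace_ln :: "complex ^ 'n ^ 'n \<Rightarrow> complex ^ 'n ^ 'n \<Rightarrow> real" where
  "trace_ln D X = Re (trace (D ** herm_fun ln X))"

lemma vn_entropy_trace_ln: "vn_entropy A = - trace_ln A A"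
  by (simp add: vn_entropy_def trace_ln_def)

text \<open>Cyclicity of the trace puts \<open>D\<close> next to its own eigenvectors, even if
  \<open>D\<close> and \<open>X\<close> do not commute.\<close>

lemma trace_ln_rayleigh:
  assumes "eigenbasis D E"
  shows "trace_ln D X = (\<Sum>v\<in>E. rayleigh D v * rayleigh (herm_fun ln X) v)"
proof -
  define H where "H = herm_fun ln X"
  have "rayleigh (H ** D) v = rayleigh D v * rayleigh H v" if "v \<in> E" for v
  proof -
    have "cinner v (H *v (D *v v)) = of_real (rayleigh D v) * cinner v (H *v v)"
      using eigenbasisD(2)[OF assms that] by (metis vector_scalar_commute cinner_scale_right)
    then show ?thesis
      by (simp add: rayleigh_def[of H] rayleigh_def[of "H ** D"] matrix_vector_mul_assoc[symmetric])
  qed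
  then show ?thesis
    by (simp add: trace_ln_def trace_mul_sym[of D] H_def
        Re_trace_orthonormal_basis[OF eigenbasisD(1)[OF assms]])
qed

lemma trace_ln_self:
  assumes "hermitian D" "eigenbasis D E"
  shows "trace_ln D D = (\<Sum>v\<in>E. rayleigh D v * ln (rayleigh D v))"
proof -
  note onb = eigenbasisD(1)[OF assms(2)]
  have "rayleigh (herm_fun ln D) v = ln (rayleigh D v)" if "v \<in> E" for v
  proof -
    have "rayleigh (herm_fun ln D) v = (\<Sum>e\<in>E. if e = v then ln (rayleigh D e) else 0)"
      unfolding rayleigh_herm_fun[OF assms]
      using that orthonormal_basisD(3)[OF onb] by (intro sum.cong) auto
    then show ?thesis
      using that orthonormal_basisD(1)[OF onb] by simp
  qed
  then show ?thesis
    by (simp add: trace_ln_rayleigh[OF assms(2)])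
qed

lemma rayleigh_add: "rayleigh (A + B) v = rayleigh A v + rayleigh B v"
  and rayleigh_scaleR: "rayleigh (r *\<^sub>R A) v = r * rayleigh A v"
  by (simp_all add: rayleigh_def matrix_vector_mult_add_rdistrib scaleR_matrix_vector_mult
      cinner_add_right cinner_scale_right)

lemma trace_ln_add: "trace_ln (A + B) X = trace_ln A X + trace_ln B X"
  by (simp add: trace_ln_def trace_def matrix_matrix_mult_def algebra_simps sum.distrib)

lemma scaleR_matrix_matrix_mult: "(r *\<^sub>R A) ** B = r *\<^sub>R (A ** B)"
  for A :: "complex ^ 'n ^ 'm"
  by (simp add: vec_eq_iff matrix_matrix_mult_def scaleR_sum_right)

lemma trace_ln_scaleR: "trace_ln (r *\<^sub>R A) X = r * trace_ln A X"
  by (simp add: trace_ln_def scaleR_matrix_matrix_mult trace_def sum_distrib_left)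

subsection \<open>Two bounds on \<open>Tr (D log X)\<close>\<close>

lemma pos_semidefD:
  assumes "pos_semidef A"
  shows "hermitian A" "rayleigh A v \<ge> 0"
  using assms by (auto simp: pos_semidef_def rayleigh_def)

text \<open>For \<open>D = \<rho>m\<close> and \<open>X = \<rho>2\<close> this is the constant
  \<open>c\<close> of the theorem.\<close>

definition supp_trace :: "complex ^ 'n ^ 'n \<Rightarrow> complex ^ 'n ^ 'n \<Rightarrow> real" where
  "supp_trace D X = Re (trace (compression (mat_supp D) X))"

lemma mat_supp_eigenbasis:
  assumes "hermitian D" "eigenbasis D E"
  shows "mat_supp D = {x. \<forall>e\<in>E - {e\<in>E. rayleigh D e \<noteq> 0}. cinner e x = 0}"
proof -
  have ker: "mat_ker D = {x. \<forall>e\<in>E - {e\<in>E. rayleigh D e = 0}. cinner e x = 0}"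
    using eigenspace_eigenbasis[OF assms, of 0] by (simp add: eigenspace_def mat_ker_def)
  show ?thesis
  proof (intro equalityI subsetI)
    fix x assume x: "x \<in> mat_supp D"
    have "cinner e x = 0" if "e \<in> E" "rayleigh D e = 0" for e
    proof -
      have "e \<in> mat_ker D"
        using that eigenbasisD(2)[OF assms(2)] by (simp add: mat_ker_def)
      then show ?thesis
        using x by (simp add: mat_supp_def corth_compl_def)
    qed
    then show "x \<in> {x. \<forall>e\<in>E - {e\<in>E. rayleigh D e \<noteq> 0}. cinner e x = 0}" by auto
  next
    fix x assume x: "x \<in> {x. \<forall>e\<in>E - {e\<in>E. rayleigh D e \<noteq> 0}. cinner e x = 0}"
    have "cinner y x = 0" if "y \<in> mat_ker D" for y
      unfolding orthonormal_basis_cinner[OF eigenbasisD(1)[OF assms(2)], of y]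
      using that x by (intro sum.neutral) (auto simp: ker)
    then show "x \<in> mat_supp D"
      by (simp add: mat_supp_def corth_compl_def)
  qed
qed

text \<open>The support projection fixes the eigenvectors of \<open>D\<close> with nonzero
  eigenvalue and kills the others, so only the diagonal entries of \<open>X\<close> at the former
  survive.\<close>

lemma supp_trace_eigenbasis:
  assumes "hermitian D" "eigenbasis D E"
  shows "supp_trace D X = (\<Sum>v\<in>{v\<in>E. rayleigh D v \<noteq> 0}. rayleigh X v)"
proof -
  note onb = eigenbasisD(1)[OF assms(2)]
  define F where "F = {v\<in>E. rayleigh D v \<noteq> 0}"
  define P where "P = orth_proj (mat_supp D)"
  have F: "F \<subseteq> E" by (auto simp: F_def)
  have P: "P *v x = (\<Sum>e\<in>F. cinner e x *s e)" for x
    unfolding P_def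
    by (rule orth_proj_mult[OF onb F]) (simp add: mat_supp_eigenbasis[OF assms] F_def)
  have Pe: "P *v e = (if e \<in> F then e else 0)" if "e \<in> E" for e
    using that by (intro orthonormal_basis_eqI[OF onb])
      (auto simp: P cinner_expansion[OF onb F] orthonormal_basisD(3)[OF onb])
  have "trace (P ** X ** P) = (\<Sum>e\<in>E. cinner e (P *v (X *v (P *v e))))"
    by (simp add: trace_orthonormal_basis[OF onb] matrix_vector_mul_assoc matrix_mul_assoc)
  also have "\<dots> = (\<Sum>e\<in>E. if e \<in> F then cinner e (X *v e) else 0)"
    by (intro sum.cong refl) (simp add: P[of "X *v _"] cinner_expansion[OF onb F] Pe)
  also have "\<dots> = (\<Sum>e\<in>F. cinner e (X *v e))"
    using F orthonormal_basisD(1)[OF onb] by (simp add: sum.inter_restrict[symmetric] Int_absorb1)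
  finally show ?thesis
    by (simp add: supp_trace_def compression_def P_def F_def rayleigh_def)
qed

lemma supp_trace_add:
  assumes "hermitian D" shows "supp_trace D (X + Y) = supp_trace D X + supp_trace D Y"
  using hermitian_eigenbasis[OF assms] supp_trace_eigenbasis[OF assms]
  by (metis (no_types, lifting) rayleigh_add sum.cong sum.distrib)

lemma supp_trace_scaleR:
  assumes "hermitian D" shows "supp_trace D (r *\<^sub>R X) = r * supp_trace D X"
  using hermitian_eigenbasis[OF assms] supp_trace_eigenbasis[OF assms]
  by (metis (no_types, lifting) rayleigh_scaleR sum.cong sum_distrib_left)

lemma supp_trace_self:
  assumes "hermitian D" shows "supp_trace D D = Re (trace D)"
proof -
  obtain E where E: "eigenbasis D E" using hermitian_eigenbasis[OF assms] .
  show ?thesis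
    unfolding supp_trace_eigenbasis[OF assms E] Re_trace_orthonormal_basis[OF eigenbasisD(1)[OF E]]
    by (intro sum.mono_neutral_left) (auto intro: orthonormal_basisD(1)[OF eigenbasisD(1)[OF E]])
qed

lemma supp_trace_nonneg_le:
  assumes "hermitian D" "pos_semidef X"
  shows "0 \<le> supp_trace D X" "supp_trace D X \<le> Re (trace X)"
proof -
  obtain E where E: "eigenbasis D E" using hermitian_eigenbasis[OF assms(1)] .
  show "0 \<le> supp_trace D X"
    unfolding supp_trace_eigenbasis[OF assms(1) E]
    by (intro sum_nonneg pos_semidefD[OF assms(2)])
  show "supp_trace D X \<le> Re (trace X)"
    unfolding supp_trace_eigenbasis[OF assms(1) E] Re_trace_orthonormal_basis[OF eigenbasisD(1)[OF E]]
    by (intro sum_mono2) (auto intro: pos_semidefD[OF assms(2)] orthonormal_basisD(1)[OF eigenbasisD(1)[OF E]])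
qed

text \<open>The form of \<open>D\<close> at \<open>w\<close> is a sum of nonnegative terms, so each
  of them vanishes. In the two bounds below this gives weight zero to eigenvectors in the kernel of
  \<open>X\<close>, where \<open>ln 0\<close> is only a default value.\<close>

lemma eigenvector_orthogonal_ker:
  assumes D: "pos_semidef D" "eigenbasis D E" and v: "v \<in> E" "rayleigh D v \<noteq> 0"
    and w: "rayleigh D w = 0"
  shows "cinner w v = 0"
proof -
  have "(\<Sum>e\<in>E. rayleigh D e * (cmod (cinner e w))\<^sup>2) = 0"
    using w rayleigh_eigenbasis[OF pos_semidefD(1)[OF D(1)] D(2)] by metis
  then have "rayleigh D v * (cmod (cinner v w))\<^sup>2 = 0"
    using v pos_semidefD(2)[OF D(1)] orthonormal_basisD(1)[OF eigenbasisD(1)[OF D(2)]]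
    by (subst (asm) sum_nonneg_eq_0_iff) auto
  then show ?thesis
    using v cinner_commute[of w v] by simp
qed

text \<open>Klein's inequality for \<open>D\<close> and \<open>\<mu> X\<close>, sharpened in that only the part of \<open>X\<close> on the
  support of \<open>D\<close> enters.\<close>

lemma trace_ln_le:
  assumes D: "pos_semidef D" and X: "pos_semidef X" and "\<mu> > 0"
    and ker: "\<And>v. rayleigh X v = 0 \<Longrightarrow> rayleigh D v = 0"
  shows "trace_ln D X \<le> trace_ln D D - (1 + ln \<mu>) * Re (trace D) + \<mu> * supp_trace D X"
proof -
  note hD = pos_semidefD(1)[OF D] and hX = pos_semidefD(1)[OF X]
  obtain E where E: "eigenbasis D E" using hermitian_eigenbasis[OF hD] .
  obtain W where W: "eigenbasis X W" using hermitian_eigenbasis[OF hX] .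
  note onbE = eigenbasisD(1)[OF E] and onbW = eigenbasisD(1)[OF W]
  note finE = orthonormal_basisD(1)[OF onbE]
  \<comment> \<open>Eigenvectors of \<open>D\<close> with eigenvalue zero add nothing to the left
    side and get no term \<open>\<mu> * rayleigh X v\<close>; hence the trace over the support
    instead of the full trace.\<close>
  have *: "rayleigh D v * rayleigh (herm_fun ln X) v
      \<le> rayleigh D v * ln (rayleigh D v) - (1 + ln \<mu>) * rayleigh D v
         + (if rayleigh D v \<noteq> 0 then \<mu> * rayleigh X v else 0)" if v: "v \<in> E" for v
  proof (cases "rayleigh D v = 0")
    case False
    define d where "d = rayleigh D v"
    have d: "d > 0" using False pos_semidefD(2)[OF D, of v] by (simp add: d_def)
    have "d * rayleigh (herm_fun ln X) v
        = (\<Sum>w\<in>W. d * ln (rayleigh X w) * (cmod (cinner w v))\<^sup>2)"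
      by (simp add: rayleigh_herm_fun[OF hX W] sum_distrib_left mult.assoc)
    \<comment> \<open>This is \<open>ln z \<le> z - 1\<close> at \<open>z = \<mu> * x / d\<close>
      for each pair of eigenvalues, weighted by the squared overlaps of the eigenvectors, which sum
      to 1 over \<open>W\<close>.\<close>
    also have "\<dots> \<le> (\<Sum>w\<in>W. (d * ln d - (1 + ln \<mu>) * d + \<mu> * rayleigh X w) * (cmod (cinner w v))\<^sup>2)"
    proof (rule sum_mono)
      fix w assume "w \<in> W"
      define x where "x = rayleigh X w"
      show "d * ln (rayleigh X w) * (cmod (cinner w v))\<^sup>2
          \<le> (d * ln d - (1 + ln \<mu>) * d + \<mu> * rayleigh X w) * (cmod (cinner w v))\<^sup>2"
      proof (cases "x = 0")
        case True
        then have "cinner w v = 0"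
          using eigenvector_orthogonal_ker[OF D E v False] ker by (simp add: x_def)
        then show ?thesis by simp
      next
        case False
        then have x: "x > 0" using pos_semidefD(2)[OF X, of w] by (simp add: x_def)
        have "ln (\<mu> * x / d) \<le> \<mu> * x / d - 1"
          using x d \<open>\<mu> > 0\<close> by (intro ln_le_minus_one) simp
        then have "ln \<mu> + ln x - ln d \<le> \<mu> * x / d - 1"
          using x d \<open>\<mu> > 0\<close> by (simp add: ln_div ln_mult)
        then have "d * (ln \<mu> + ln x - ln d) \<le> d * (\<mu> * x / d - 1)"
          using d by simp
        also have "\<dots> = \<mu> * x - d"
          using d by (simp add: right_diff_distrib)
        finally have "d * ln x \<le> d * ln d - (1 + ln \<mu>) * d + \<mu> * x"
          by (simp add: algebra_simps)
        then show ?thesis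
          unfolding x_def by (rule mult_right_mono) simp
      qed
    qed
    also have "\<dots> = (d * ln d - (1 + ln \<mu>) * d) * (\<Sum>w\<in>W. (cmod (cinner w v))\<^sup>2)
        + \<mu> * (\<Sum>w\<in>W. rayleigh X w * (cmod (cinner w v))\<^sup>2)"
      by (simp add: distrib_right sum.distrib sum_distrib_left mult.assoc)
    also have "\<dots> = d * ln d - (1 + ln \<mu>) * d + \<mu> * rayleigh X v"
      by (simp add: orthonormal_basis_parseval[OF onbW] orthonormal_basis_norm[OF onbE v]
          rayleigh_eigenbasis[OF hX W, symmetric])
    finally show ?thesis
      using False by (simp add: d_def)
  qed simp
  have supp: "(\<Sum>v\<in>E. if rayleigh D v \<noteq> 0 then \<mu> * rayleigh X v else 0) = \<mu> * supp_trace D X"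
    unfolding supp_trace_eigenbasis[OF hD E] sum_distrib_left using finE by (simp add: sum.inter_filter)
  have "trace_ln D X \<le> (\<Sum>v\<in>E. rayleigh D v * ln (rayleigh D v) - (1 + ln \<mu>) * rayleigh D v
      + (if rayleigh D v \<noteq> 0 then \<mu> * rayleigh X v else 0))"
    unfolding trace_ln_rayleigh[OF E] by (rule sum_mono) (rule *)
  also have "\<dots> = trace_ln D D - (1 + ln \<mu>) * Re (trace D) + \<mu> * supp_trace D X"
    unfolding sum.distrib supp
    by (simp add: trace_ln_self[OF hD E] Re_trace_orthonormal_basis[OF onbE] sum_subtractf sum_distrib_left)
  finally show ?thesis .
qed

text \<open>A trace form of the operator monotonicity of the logarithm.\<close>

lemma trace_ln_ge:
  assumes B: "pos_semidef B" and X: "pos_semidef X" and "s > 0"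
    and le: "\<And>v. s * rayleigh B v \<le> rayleigh X v"
  shows "trace_ln B B + ln s * Re (trace B) \<le> trace_ln B X"
proof -
  note hB = pos_semidefD(1)[OF B] and hX = pos_semidefD(1)[OF X]
  obtain E where E: "eigenbasis B E" using hermitian_eigenbasis[OF hB] .
  obtain W where W: "eigenbasis X W" using hermitian_eigenbasis[OF hX] .
  note onbE = eigenbasisD(1)[OF E] and onbW = eigenbasisD(1)[OF W]
  note finE = orthonormal_basisD(1)[OF onbE]
  have *: "rayleigh B v * ln (rayleigh B v) + ln s * rayleigh B v
      \<le> rayleigh B v * rayleigh (herm_fun ln X) v" if v: "v \<in> E" for v
  proof (cases "rayleigh B v = 0")
    case False
    define b where "b = rayleigh B v"
    have b: "b > 0" using False pos_semidefD(2)[OF B, of v] by (simp add: b_def)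
    define p where "p w = (cmod (cinner w v))\<^sup>2" for w
    have p_zero: "p w = 0" if "rayleigh X w = 0" for w
    proof -
      have "rayleigh B w = 0"
        using le[of w] that pos_semidefD(2)[OF B, of w] \<open>s > 0\<close> by (simp add: mult_le_0_iff)
      then show ?thesis
        using eigenvector_orthogonal_ker[OF B E v False] by (simp add: p_def)
    qed
    \<comment> \<open>\<open>r = \<langle>v, X\<^sup>-\<^sup>1 v\<rangle>\<close> and \<open>y = X\<^sup>-\<^sup>1 v\<close>, pseudo-inverse thanks to \<open>x / 0 = 0\<close>.\<close>
    define r where "r = (\<Sum>w\<in>W. p w / rayleigh X w)"
    define y where "y = (\<Sum>w\<in>W. (cinner w v / of_real (rayleigh X w)) *s w)"
    have wy: "cinner w y = cinner w v / of_real (rayleigh X w)" if "w \<in> W" for w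
      using that by (simp add: y_def cinner_expansion[OF onbW])
    have "rayleigh X y = (\<Sum>w\<in>W. rayleigh X w * (cmod (cinner w v) / rayleigh X w)\<^sup>2)"
      unfolding rayleigh_eigenbasis[OF hX W, of y]
      by (intro sum.cong refl) (simp add: wy norm_divide power_divide)
    also have "\<dots> = r"
      unfolding r_def p_def by (intro sum.cong refl) (simp add: field_simps power2_eq_square)
    finally have Xy: "rayleigh X y = r" .
    have "cinner v y = of_real r"
      unfolding orthonormal_basis_cinner[OF onbW, of v] r_def of_real_sum p_def
      by (intro sum.cong refl) (simp add: wy complex_norm_square mult.commute flip: of_real_power)
    \<comment> \<open>Keeping only the \<open>v\<close> term in the form of \<open>B\<close> at
      \<open>y\<close>, and using \<open>le\<close> at \<open>y\<close>, gives
      \<open>s * b * r\<^sup>2 \<le> r\<close>, hence \<open>s * b * r \<le> 1\<close>.\<close>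
    then have "b * r\<^sup>2 = b * (cmod (cinner v y))\<^sup>2"
      by simp
    also have "\<dots> \<le> rayleigh B y"
      unfolding rayleigh_eigenbasis[OF hB E, of y] b_def
      using v finE by (intro member_le_sum) (auto intro!: mult_nonneg_nonneg pos_semidefD(2)[OF B])
    finally have "s * (b * r\<^sup>2) \<le> s * rayleigh B y"
      using \<open>s > 0\<close> by simp
    also have "\<dots> \<le> r"
      using le[of y] Xy by simp
    finally have "s * b * r\<^sup>2 \<le> r"
      by (simp add: mult.assoc)
    then have "r * (1 - s * b * r) \<ge> 0"
      by (simp add: algebra_simps power2_eq_square)
    moreover have "r \<ge> 0"
      using Xy pos_semidefD(2)[OF X] by metis
    ultimately have r: "s * b * r \<le> 1"
      by (cases "r = 0") (auto simp: zero_le_mult_iff)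
    have sum_p: "(\<Sum>w\<in>W. p w) = 1"
      by (simp add: p_def orthonormal_basis_parseval[OF onbW] orthonormal_basis_norm[OF onbE v])
    have "0 \<le> 1 - s * b * r" using r by simp
    \<comment> \<open>The bound on the mean of \<open>1 / x\<close> passes to the mean of
      \<open>ln x\<close> through \<open>1 - s * b / x \<le> ln x - ln (s * b)\<close>, averaged
      with the weights \<open>p\<close>.\<close>
    also have "\<dots> = (\<Sum>w\<in>W. p w * (1 - s * b / rayleigh X w))"
      by (simp add: sum_p right_diff_distrib sum_subtractf r_def sum_distrib_left mult_ac)
    also have "\<dots> \<le> (\<Sum>w\<in>W. p w * (ln (rayleigh X w) - ln (s * b)))"
    proof (rule sum_mono)
      fix w
      define x where "x = rayleigh X w"
      show "p w * (1 - s * b / rayleigh X w) \<le> p w * (ln (rayleigh X w) - ln (s * b))"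
      proof (cases "x = 0")
        case False
        then have x: "x > 0" using pos_semidefD(2)[OF X, of w] by (simp add: x_def)
        have "ln (s * b / x) \<le> s * b / x - 1"
          using x b \<open>s > 0\<close> by (intro ln_le_minus_one) simp
        then have "1 - s * b / x \<le> ln x - ln (s * b)"
          using x b \<open>s > 0\<close> by (simp add: ln_div)
        then show ?thesis
          unfolding x_def by (rule mult_left_mono) (simp add: p_def)
      qed (simp add: p_zero x_def)
    qed
    also have "\<dots> = rayleigh (herm_fun ln X) v - ln (s * b)"
      by (simp add: rayleigh_herm_fun[OF hX W] right_diff_distrib sum_subtractf
          sum_distrib_right[symmetric] sum_p p_def[symmetric] mult.commute)
    finally have "b * (ln s + ln b) \<le> b * rayleigh (herm_fun ln X) v"
      using b \<open>s > 0\<close> by (simp add: ln_mult)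
    then show ?thesis
      by (simp add: b_def algebra_simps)
  qed simp
  have "trace_ln B B + ln s * Re (trace B)
      = (\<Sum>v\<in>E. rayleigh B v * ln (rayleigh B v) + ln s * rayleigh B v)"
    by (simp add: trace_ln_self[OF hB E] Re_trace_orthonormal_basis[OF onbE] sum.distrib
        sum_distrib_left)
  also have "\<dots> \<le> trace_ln B X"
    unfolding trace_ln_rayleigh[OF E] by (rule sum_mono) (rule *)
  finally show ?thesis .
qed

subsection \<open>The entropy of a sum\<close>

lemma xlnx_increment:
  fixes a b :: real
  assumes "0 < a" "0 < b"
  shows "(b - a) * ln a \<le> (b * ln b - b) - (a * ln a - a)"
proof -
  \<comment> \<open>The claim is convexity: the graph lies above its tangent at \<open>a\<close>,
    whose slope is \<open>ln a\<close>.\<close>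
  have "ln (a / b) \<le> a / b - 1"
    using assms by (intro ln_le_minus_one) simp
  then have "b * (ln a - ln b) \<le> b * (a / b - 1)"
    using assms by (simp add: ln_div)
  also have "\<dots> = a - b"
    using assms by (simp add: right_diff_distrib)
  finally show ?thesis
    by (simp add: algebra_simps)
qed

text \<open>The limit is one-sided because \<open>a = 0\<close> occurs, namely when
  \<open>\<rho>1\<close> has no mass on the support of \<open>\<rho>m\<close>; there
  \<open>0 * ln 0 = 0\<close> agrees with the limit of \<open>h * ln h\<close>.\<close>

lemma xlnx_tendsto_at_right:
  fixes a :: real
  assumes "a \<ge> 0"
  shows "((\<lambda>h. (a + h) * ln (a + h) - (a + h)) \<longlongrightarrow> a * ln a - a) (at_right 0)"
proof (cases "a = 0")
  case True
  have "((\<lambda>h::real. h * ln h - h) \<longlongrightarrow> 0) (at_right 0)" by real_asymp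
  then show ?thesis using True by simp
next
  case False
  then show ?thesis
    using assms by (auto intro!: tendsto_eq_intros)
qed

text \<open>A Riemann sum for \<open>\<integral> K - ln (\<alpha> + t) dt\<close>.\<close>

lemma increment_ge_integral_ln:
  fixes f :: "real \<Rightarrow> real"
  assumes "\<alpha> \<ge> 0" "\<epsilon> > 0"
    and step: "\<And>s t. \<lbrakk>0 \<le> s; s < t\<rbrakk> \<Longrightarrow> f t - f s \<ge> (t - s) * (K - ln (\<alpha> + t))"
  shows "f \<epsilon> - f 0 \<ge> \<epsilon> * K - (((\<alpha> + \<epsilon>) * ln (\<alpha> + \<epsilon>) - (\<alpha> + \<epsilon>)) - (\<alpha> * ln \<alpha> - \<alpha>))"
proof -
  define G where "G x = x * ln x - x" for x :: real
  define h where "h N = \<epsilon> / real (Suc N)" for N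
  have h: "h N > 0" "real (Suc N) * h N = \<epsilon>" for N
    using \<open>\<epsilon> > 0\<close> by (simp_all add: h_def)
  have bound: "\<epsilon> * K - (G (\<alpha> + \<epsilon> + h N) - G (\<alpha> + h N)) \<le> f \<epsilon> - f 0" for N
  proof -
    define t where "t k = real k * h N" for k
    have t: "t (Suc k) = t k + h N" "t k \<ge> 0" for k
      using h[of N] by (simp_all add: t_def algebra_simps)
    \<comment> \<open>\<open>step\<close> supplies \<open>ln\<close> at the right endpoint of a
      cell. As \<open>ln\<close> increases, it is compared with the integral over the next cell,
      whose left endpoint gives a positive argument even if \<open>\<alpha> = 0\<close>. The total
      thus refers to the interval shifted by \<open>h N\<close>.\<close>
    have "h N * K - (G (\<alpha> + t (Suc (Suc k))) - G (\<alpha> + t (Suc k))) \<le> f (t (Suc k)) - f (t k)" for k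
    proof -
      have "t (Suc j) > 0" for j
        using h(1)[of N] by (simp add: t_def)
      then have pos: "\<alpha> + t (Suc k) > 0" "\<alpha> + t (Suc (Suc k)) > 0"
        using \<open>\<alpha> \<ge> 0\<close> by (simp_all only: add_nonneg_pos)
      have "h N * ln (\<alpha> + t (Suc k)) \<le> G (\<alpha> + t (Suc (Suc k))) - G (\<alpha> + t (Suc k))"
        using xlnx_increment[OF pos] by (simp add: G_def t(1)[of "Suc k"])
      moreover have "h N * (K - ln (\<alpha> + t (Suc k))) \<le> f (t (Suc k)) - f (t k)"
        using step[of "t k" "t (Suc k)"] t h[of N] by simp
      ultimately show ?thesis
        by (simp add: right_diff_distrib)
    qed
    then have "(\<Sum>k<Suc N. h N * K - (G (\<alpha> + t (Suc (Suc k))) - G (\<alpha> + t (Suc k))))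
        \<le> (\<Sum>k<Suc N. f (t (Suc k)) - f (t k))"
      by (rule sum_mono)
    moreover have "(\<Sum>k<Suc N. f (t (Suc k)) - f (t k)) = f (t (Suc N)) - f (t 0)"
      by (rule sum_lessThan_telescope)
    moreover have "(\<Sum>k<Suc N. G (\<alpha> + t (Suc (Suc k))) - G (\<alpha> + t (Suc k)))
        = G (\<alpha> + t (Suc (Suc N))) - G (\<alpha> + t (Suc 0))"
      by (rule sum_lessThan_telescope)
    ultimately have "real (Suc N) * (h N * K) - (G (\<alpha> + t (Suc (Suc N))) - G (\<alpha> + t (Suc 0)))
        \<le> f (t (Suc N)) - f (t 0)"
      by (simp add: sum_subtractf)
    moreover have "real (Suc N) * (h N * K) = \<epsilon> * K"
      using h(2)[of N] by (simp only: mult.assoc[symmetric])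
    moreover have t_end: "t (Suc N) = \<epsilon>"
      using h(2)[of N] by (simp only: t_def)
    moreover have "t (Suc (Suc N)) = \<epsilon> + h N" "t 0 = 0" "t (Suc 0) = h N"
      using t(1)[of "Suc N"] t_end by (simp_all add: t_def)
    ultimately show ?thesis by (simp only: add.assoc diff_zero)
  qed
  have "(\<lambda>N. \<epsilon> * inverse (real (Suc N))) \<longlonglongrightarrow> \<epsilon> * 0"
    by (intro tendsto_intros LIMSEQ_inverse_real_of_nat)
  then have "h \<longlonglongrightarrow> 0"
    by (simp add: h_def[abs_def] divide_inverse)
  then have h_lim: "filterlim h (at_right 0) sequentially"
    by (rule tendsto_imp_filterlim_at_right) (simp add: h(1))
  have lim: "(\<lambda>N. G (a + h N)) \<longlonglongrightarrow> G a" if "a \<ge> 0" for a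
    unfolding G_def by (rule filterlim_compose[OF xlnx_tendsto_at_right[OF that] h_lim])
  have "(\<lambda>N. \<epsilon> * K - (G (\<alpha> + \<epsilon> + h N) - G (\<alpha> + h N))) \<longlonglongrightarrow> \<epsilon> * K - (G (\<alpha> + \<epsilon>) - G \<alpha>)"
    using assms by (intro tendsto_intros lim) auto
  then have "\<epsilon> * K - (G (\<alpha> + \<epsilon>) - G \<alpha>) \<le> f \<epsilon> - f 0"
    by (rule LIMSEQ_le_const2) (use bound in auto)
  then show ?thesis by (simp add: G_def)
qed

section \<open>Entropy bounds for a positive operator plus a multiple of a state\<close>

lemma cadjoint_add: "cadjoint (A + B) = cadjoint A + cadjoint B"
  and cadjoint_scaleR: "cadjoint (r *\<^sub>R A) = r *\<^sub>R cadjoint A"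
  by (simp_all add: cadjoint_def vec_eq_iff)

lemma pos_semidef_add_scaleR:
  assumes "pos_semidef A" "pos_semidef B" "r \<ge> 0"
  shows "pos_semidef (A + r *\<^sub>R B)"
proof -
  have "0 \<le> rayleigh (A + r *\<^sub>R B) x" for x
    using assms by (simp add: rayleigh_add rayleigh_scaleR pos_semidefD)
  then show ?thesis
    using assms(1,2)
    by (simp add: pos_semidef_def hermitian_def cadjoint_add cadjoint_scaleR rayleigh_def)
qed

lemma Re_trace_add_scaleR: "Re (trace (A + r *\<^sub>R B)) = Re (trace A) + r * Re (trace B)"
  by (simp add: trace_def sum.distrib sum_distrib_left)

text \<open>Klein's inequality for \<open>Y\<close> against \<open>X\<close> yields the
  \<open>- 1\<close> from the trace difference \<open>t - s\<close>; the rest,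
  \<open>(t - s) * trace_ln R X\<close>, yields the entropy of \<open>R\<close> and the logarithm.
  Since \<open>t > 0\<close>, the kernel of \<open>X\<close> lies in those of \<open>A\<close> and
  \<open>R\<close>.\<close>

lemma vn_entropy_increment:
  assumes A: "pos_semidef A" and R: "pos_semidef R" "trace R = 1" and st: "0 \<le> s" "s < t"
  shows "vn_entropy (A + t *\<^sub>R R) - vn_entropy (A + s *\<^sub>R R)
    \<ge> (t - s) * ((vn_entropy R - 1) - ln (supp_trace R A + t))"
proof -
  define X where "X = A + t *\<^sub>R R"
  define Y where "Y = A + s *\<^sub>R R"
  define c where "c = supp_trace R A + t"
  note hR = pos_semidefD(1)[OF R(1)]
  have X: "pos_semidef X" and Y: "pos_semidef Y"
    using A R st by (auto simp: X_def Y_def intro!: pos_semidef_add_scaleR)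
  have c: "c > 0"
    using supp_trace_nonneg_le(1)[OF hR A] st by (simp add: c_def)
  have kerX: "rayleigh A v = 0 \<and> rayleigh R v = 0" if "rayleigh X v = 0" for v
    using that st pos_semidefD(2)[OF A, of v] pos_semidefD(2)[OF R(1), of v]
    by (simp add: X_def rayleigh_add rayleigh_scaleR add_nonneg_eq_0_iff)
  \<comment> \<open>\<open>c\<close> is the mass of \<open>X\<close> on the support of
    \<open>R\<close>, and \<open>\<mu> = 1 / c\<close> minimises
    \<open>\<mu> * c - ln \<mu>\<close>.\<close>
  have "trace_ln R X \<le> trace_ln R R - (1 + ln (1 / c)) * 1 + 1 / c * supp_trace R X"
    using trace_ln_le[OF R(1) X, of "1 / c"] c kerX R(2) by simp
  moreover have "supp_trace R X = c"
    by (simp add: X_def c_def supp_trace_add[OF hR] supp_trace_scaleR[OF hR] supp_trace_self[OF hR] R(2))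
  ultimately have 1: "trace_ln R X \<le> trace_ln R R + ln c"
    using c by (simp add: ln_div)
  have "trace_ln Y X \<le> trace_ln Y Y - Re (trace Y) + supp_trace Y X"
    using trace_ln_le[OF Y X, of 1] kerX by (simp add: Y_def rayleigh_add rayleigh_scaleR)
  also have "\<dots> \<le> trace_ln Y Y - Re (trace Y) + Re (trace X)"
    using supp_trace_nonneg_le(2)[OF pos_semidefD(1)[OF Y] X] by simp
  also have "\<dots> = trace_ln Y Y + (t - s)"
    by (simp add: X_def Y_def Re_trace_add_scaleR R(2))
  finally have "trace_ln Y X \<le> trace_ln Y Y + (t - s)" .
  \<comment> \<open>Only the first argument is unfolded, so the logarithm stays that of
    \<open>X\<close>.\<close>
  moreover have "trace_ln X X = trace_ln Y X + (t - s) * trace_ln R X"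
    by (simp add: X_def[THEN arg_cong[of _ _ "\<lambda>Z. trace_ln Z X"]] Y_def trace_ln_add trace_ln_scaleR algebra_simps)
  moreover have "(t - s) * trace_ln R X \<le> (t - s) * (trace_ln R R + ln c)"
    using 1 st by simp
  ultimately show ?thesis
    unfolding vn_entropy_trace_ln X_def[symmetric] Y_def[symmetric] c_def[symmetric]
    by (simp add: algebra_simps)
qed

text \<open>The increments are integrated from 0 to \<open>\<epsilon>\<close> with
  \<open>\<alpha> = c - \<epsilon>\<close>; the \<open>- 1\<close> in the integrand cancels the
  linear terms of the antiderivative.\<close>

lemma vn_entropy_add_ge:
  assumes "pos_semidef A" "pos_semidef R" "trace R = 1" "\<epsilon> > 0" and c: "c = supp_trace R A + \<epsilon>"
  shows "vn_entropy (A + \<epsilon> *\<^sub>R R)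
    \<ge> vn_entropy A + \<epsilon> * vn_entropy R - c * ln c + (c - \<epsilon>) * ln (c - \<epsilon>)"
proof -
  have "vn_entropy (A + \<epsilon> *\<^sub>R R) - vn_entropy (A + 0 *\<^sub>R R) \<ge> \<epsilon> * (vn_entropy R - 1)
    - (((supp_trace R A + \<epsilon>) * ln (supp_trace R A + \<epsilon>) - (supp_trace R A + \<epsilon>))
      - (supp_trace R A * ln (supp_trace R A) - supp_trace R A))"
    using assms vn_entropy_increment[OF assms(1-3)]
    by (intro increment_ge_integral_ln supp_trace_nonneg_le pos_semidefD) auto
  then show ?thesis
    by (simp add: c right_diff_distrib)
qed

text \<open>The sum dominates \<open>B\<close> with factor 1 and \<open>R\<close> with factor
  \<open>\<epsilon>\<close>, and the latter factor produces
  \<open>- \<epsilon> * ln \<epsilon>\<close>.\<close>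

lemma vn_entropy_add_le:
  assumes B: "pos_semidef B" and R: "pos_semidef R" "trace R = 1" and "\<epsilon> > 0"
  shows "vn_entropy (B + \<epsilon> *\<^sub>R R) \<le> vn_entropy B + \<epsilon> * vn_entropy R - \<epsilon> * ln \<epsilon>"
proof -
  define X where "X = B + \<epsilon> *\<^sub>R R"
  have X: "pos_semidef X"
    using assms by (simp add: X_def pos_semidef_add_scaleR)
  have "trace_ln B B \<le> trace_ln B X"
    using trace_ln_ge[OF B X, of 1] pos_semidefD(2)[OF R(1)] \<open>\<epsilon> > 0\<close>
    by (simp add: X_def rayleigh_add rayleigh_scaleR)
  moreover have "trace_ln R R + ln \<epsilon> \<le> trace_ln R X"
    using trace_ln_ge[OF R(1) X, of \<epsilon>] pos_semidefD(2)[OF B] \<open>\<epsilon> > 0\<close> R(2)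
    by (simp add: X_def rayleigh_add rayleigh_scaleR)
  then have "\<epsilon> * (trace_ln R R + ln \<epsilon>) \<le> \<epsilon> * trace_ln R X"
    using \<open>\<epsilon> > 0\<close> by simp
  moreover have "trace_ln X X = trace_ln B X + \<epsilon> * trace_ln R X"
    by (simp add: X_def[THEN arg_cong[of _ _ "\<lambda>Z. trace_ln Z X"]] trace_ln_add trace_ln_scaleR)
  ultimately show ?thesis
    by (simp add: vn_entropy_trace_ln X_def[symmetric] algebra_simps)
qed

text \<open>Eigenvectors spanning the support of \<open>B\<close> are orthogonal to that of
  \<open>A\<close>, so \<open>A\<close> has zero diagonal there. This removes \<open>\<rho>p\<close>
  from the mass balance that identifies \<open>c\<close>.\<close>

lemma supp_trace_orth_supports:
  assumes A: "hermitian A" and B: "hermitian B" and orth: "orth_supports A B"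
  shows "supp_trace B A = 0"
proof -
  obtain E where E: "eigenbasis A E" using hermitian_eigenbasis[OF A] .
  obtain W where W: "eigenbasis B W" using hermitian_eigenbasis[OF B] .
  have in_supp: "e \<in> mat_supp C" if "hermitian C" "eigenbasis C F" "e \<in> F" "rayleigh C e \<noteq> 0" for C F e
    using that orthonormal_basisD(3)[OF eigenbasisD(1)[OF that(2)]]
    by (auto simp: mat_supp_eigenbasis[OF that(1,2)])
  have "rayleigh A w = 0" if w: "w \<in> W" "rayleigh B w \<noteq> 0" for w
  proof -
    have "cinner e w = 0" if "e \<in> E" "rayleigh A e \<noteq> 0" for e
      using orth in_supp[OF A E that] in_supp[OF B W w] unfolding orth_supports_def by blast
    then show ?thesis
      unfolding rayleigh_eigenbasis[OF A E, of w] by (intro sum.neutral) auto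
  qed
  then show ?thesis
    by (simp add: supp_trace_eigenbasis[OF B W])
qed

theorem theorem3:
  fixes \<rho>1 \<rho>2 \<rho>p \<rho>m :: "complex ^ 'n ^ 'n" and \<epsilon> c :: real
  assumes "\<rho>1 \<in> density_matrices" and "\<rho>2 \<in> density_matrices"
    and "\<epsilon> \<in> {0..1}" and "trace_norm (\<rho>1 - \<rho>2) / 2 = \<epsilon>"
    and "\<rho>p \<in> density_matrices" and "\<rho>m \<in> density_matrices"
    and "orth_supports \<rho>p \<rho>m"
    and "\<rho>1 - \<rho>2 = \<epsilon> *\<^sub>R \<rho>p - \<epsilon> *\<^sub>R \<rho>m"
    and "c = Re (trace (compression (mat_supp \<rho>m) \<rho>2))"
  shows "vn_entropy \<rho>1 - vn_entropy \<rho>2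
    \<le> \<epsilon> * vn_entropy \<rho>p - \<epsilon> * vn_entropy \<rho>m + c * binary_entropy (\<epsilon> / c)"
proof (cases "\<epsilon> = 0")
  case True
  \<comment> \<open>The two states coincide and \<open>binary_entropy 0 = 0\<close>; the quotient
    \<open>0 / c\<close> is 0 also for \<open>c = 0\<close>.\<close>
  then show ?thesis
    using assms(8) by (simp add: binary_entropy_def)
next
  case False
  then have \<epsilon>: "\<epsilon> > 0" using assms(3) by simp
  have psd: "pos_semidef \<rho>1" "pos_semidef \<rho>2" "pos_semidef \<rho>p" "pos_semidef \<rho>m"
    and tr: "trace \<rho>p = 1" "trace \<rho>m = 1"
    using assms(1,2,5,6) by (simp_all add: density_matrices_def)
  note hm = pos_semidefD(1)[OF psd(4)]
  have eq: "\<rho>1 + \<epsilon> *\<^sub>R \<rho>m = \<rho>2 + \<epsilon> *\<^sub>R \<rho>p"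
    using assms(8) by (simp add: algebra_simps)
  \<comment> \<open>On its own support \<open>\<rho>m\<close> has mass 1 and \<open>\<rho>p\<close>
    has none, so comparing both sides shows that \<open>c - \<epsilon>\<close> is the mass of
    \<open>\<rho>1\<close> there.\<close>
  have "supp_trace \<rho>m (\<rho>1 + \<epsilon> *\<^sub>R \<rho>m) = supp_trace \<rho>m (\<rho>2 + \<epsilon> *\<^sub>R \<rho>p)"
    by (simp add: eq)
  then have c: "c = supp_trace \<rho>m \<rho>1 + \<epsilon>"
    using supp_trace_orth_supports[OF pos_semidefD(1)[OF psd(3)] hm assms(7)] tr assms(9)
    by (simp add: supp_trace_add[OF hm] supp_trace_scaleR[OF hm] supp_trace_self[OF hm]
        supp_trace_def[of _ \<rho>2])
  then have "c \<ge> \<epsilon>"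
    using supp_trace_nonneg_le(1)[OF hm psd(1)] by simp
  have "vn_entropy \<rho>1 + \<epsilon> * vn_entropy \<rho>m - c * ln c + (c - \<epsilon>) * ln (c - \<epsilon>)
      \<le> vn_entropy \<rho>2 + \<epsilon> * vn_entropy \<rho>p - \<epsilon> * ln \<epsilon>"
    using vn_entropy_add_ge[OF psd(1,4) tr(2) \<epsilon> c] vn_entropy_add_le[OF psd(2,3) tr(1) \<epsilon>] eq
    by simp
  moreover have "c * binary_entropy (\<epsilon> / c) = c * ln c - \<epsilon> * ln \<epsilon> - (c - \<epsilon>) * ln (c - \<epsilon>)"
  proof -
    have cpos: "c > 0" using \<epsilon> \<open>c \<ge> \<epsilon>\<close> by simp
    \<comment> \<open>If \<open>c = \<epsilon>\<close>, the logarithm of 0 appears on both sides,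
      but with prefactor zero.\<close>
    have "c * ((1 - \<epsilon> / c) * ln (1 - \<epsilon> / c)) = (c - \<epsilon>) * (ln (c - \<epsilon>) - ln c)"
    proof (cases "c = \<epsilon>")
      case False
      then have "ln (1 - \<epsilon> / c) = ln (c - \<epsilon>) - ln c"
        using cpos \<open>c \<ge> \<epsilon>\<close> ln_div[of "c - \<epsilon>" c] by (simp add: diff_divide_distrib)
      moreover have "c * (1 - \<epsilon> / c) = c - \<epsilon>"
        using cpos by (simp add: right_diff_distrib)
      ultimately show ?thesis by (simp only: mult.assoc[symmetric])
    qed simp
    moreover have "c * (- (\<epsilon> / c) * ln (\<epsilon> / c)) = - \<epsilon> * (ln \<epsilon> - ln c)"
      using cpos \<epsilon> by (simp add: ln_div)
    ultimately show ?thesis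
      by (simp add: binary_entropy_def right_diff_distrib algebra_simps)
  qed
  ultimately show ?thesis by simp
qed

end
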